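(* Let $n=2m+1$ and fix $c=(c_1,\dots,c_{n-1})\in\mathbb{C}^{n-1}$ with $c_i\neq 0$ for all $i$. Then the set of potentials $a=(a_1,\dots,a_n)\in\mathbb{C}^n$ for which $P_n(t,\lambda)$ admits a constant branch has codimension exactly $m$ in $\mathbb{C}^n$.
   Context: For $a=(a_1,\dots,a_n)\in\mathbb{C}^n$ (the potential, or diagonal entries) and $c=(c_1,\dots,c_{n-1})\in\mathbb{C}^{n-1}$ (the couplings), the reduced continuant $P_n(t,\lambda)\in\mathbb{C}[t,\lambda]$ is defined by $P_0=1$, $P_1=\lambda+a_1$, $P_k=(\lambda+a_k)P_{k-1}-t\,c_{k-1}P_{k-2}$ for $2\le k\le n$. A constant branch of $P_n$ is a factor of $P_n(t,\lambda)$ in $\mathbb{C}[t,\lambda]$ of the form $\lambda+\alpha$ with $\alpha\in\mathbb{C}$. Codimension is with respect to the Zariski topology (dimension of algebraic sets). *)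

theory Defs
  imports "HOL-Analysis.Analysis" "HOL-Computational_Algebra.Polynomial"
begin

section \<open>Reduced continuants\<close>

text \<open>
  The ring \<open>\<complex>[t, \<lambda>]\<close> is rendered as \<open>\<complex>[t][\<lambda>]\<close>: the outer indeterminate
  of \<^typ>\<open>complex poly poly\<close> is \<open>\<lambda>\<close>, the inner one is \<open>t\<close>.
\<close>

definition pvar_t :: "complex poly poly" where
  "pvar_t = [:[:0, 1:]:]"

definition pvar_lambda :: "complex poly poly" where
  "pvar_lambda = [:0, 1:]"

definition pconst :: "complex \<Rightarrow> complex poly poly" where
  "pconst z = [:[:z:]:]"

fun reduced_continuant ::
    "(nat \<Rightarrow> complex) \<Rightarrow> (nat \<Rightarrow> complex) \<Rightarrow> nat \<Rightarrow> complex poly poly" where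
  "reduced_continuant a c 0 = 1"
| "reduced_continuant a c (Suc 0) = pvar_lambda + pconst (a 1)"
| "reduced_continuant a c (Suc (Suc k)) =
     (pvar_lambda + pconst (a (k + 2))) * reduced_continuant a c (Suc k)
     - pvar_t * pconst (c (k + 1)) * reduced_continuant a c k"

definition has_constant_branch :: "complex poly poly \<Rightarrow> bool" where
  "has_constant_branch P \<longleftrightarrow> (\<exists>\<alpha>. (pvar_lambda + pconst \<alpha>) dvd P)"


section \<open>The Zariski topology on complex affine space\<close>

text \<open>
  Points of \<open>\<complex>\<^sup>n\<close> are functions with coordinates \<open>1, \<dots>, n\<close>; extensionality makes
  the value outside \<open>{1..n}\<close> irrelevant.
\<close>

definition complex_space :: "nat \<Rightarrow> (nat \<Rightarrow> complex) set" where
  "complex_space n = {1..n} \<rightarrow>\<^sub>E UNIV"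

inductive_set polynomial_maps :: "nat \<Rightarrow> ((nat \<Rightarrow> complex) \<Rightarrow> complex) set" for n where
  const: "(\<lambda>x. z) \<in> polynomial_maps n"
| coord: "i \<in> {1..n} \<Longrightarrow> (\<lambda>x. x i) \<in> polynomial_maps n"
| add: "f \<in> polynomial_maps n \<Longrightarrow> g \<in> polynomial_maps n \<Longrightarrow> (\<lambda>x. f x + g x) \<in> polynomial_maps n"
| mult: "f \<in> polynomial_maps n \<Longrightarrow> g \<in> polynomial_maps n \<Longrightarrow> (\<lambda>x. f x * g x) \<in> polynomial_maps n"

definition zero_locus :: "nat \<Rightarrow> ((nat \<Rightarrow> complex) \<Rightarrow> complex) set \<Rightarrow> (nat \<Rightarrow> complex) set" where
  "zero_locus n F = {x \<in> complex_space n. \<forall>f\<in>F. f x = 0}"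

definition algebraic_set :: "nat \<Rightarrow> (nat \<Rightarrow> complex) set \<Rightarrow> bool" where
  "algebraic_set n Z \<longleftrightarrow> (\<exists>F \<subseteq> polynomial_maps n. Z = zero_locus n F)"

definition zariski_topology :: "nat \<Rightarrow> (nat \<Rightarrow> complex) topology" where
  "zariski_topology n =
     topology (\<lambda>U. U \<subseteq> complex_space n \<and> algebraic_set n (complex_space n - U))"

lemma algebraic_set_Un:
  assumes "algebraic_set n A" "algebraic_set n B"
  shows "algebraic_set n (A \<union> B)"
proof -
  obtain F G where F: "F \<subseteq> polynomial_maps n" "A = zero_locus n F"
    and G: "G \<subseteq> polynomial_maps n" "B = zero_locus n G"
    using assms by (auto simp: algebraic_set_def)
  let ?H = "{(\<lambda>x. f x * g x) | f g. f \<in> F \<and> g \<in> G}"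
  have "?H \<subseteq> polynomial_maps n"
    using F(1) G(1) by (auto intro: polynomial_maps.mult)
  moreover have "A \<union> B = zero_locus n ?H"
  proof (intro equalityI subsetI)
    fix x assume "x \<in> A \<union> B"
    then show "x \<in> zero_locus n ?H"
      unfolding F(2) G(2) zero_locus_def by auto
  next
    fix x assume x: "x \<in> zero_locus n ?H"
    then have xn: "x \<in> complex_space n" by (simp add: zero_locus_def)
    have *: "f x * g x = 0" if "f \<in> F" "g \<in> G" for f g
    proof -
      have "(\<lambda>x. f x * g x) \<in> ?H" using that by blast
      moreover have "\<forall>h\<in>?H. h x = 0"
        using x unfolding zero_locus_def by (elim CollectE conjE)
      ultimately show ?thesis by (rule bspec[rotated])
    qed
    show "x \<in> A \<union> B"
    proof (cases "x \<in> A")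
      case False
      then obtain f where f: "f \<in> F" "f x \<noteq> 0" using xn by (auto simp: F(2) zero_locus_def)
      have "\<forall>g\<in>G. g x = 0" using *[OF f(1)] f(2) by simp
      then show ?thesis using xn by (simp add: G(2) zero_locus_def)
    qed simp
  qed
  ultimately show ?thesis by (auto simp: algebraic_set_def)
qed

lemma algebraic_set_Inter:
  assumes "\<And>Z. Z \<in> \<Z> \<Longrightarrow> algebraic_set n Z"
  shows "algebraic_set n (complex_space n \<inter> \<Inter>\<Z>)"
proof -
  let ?H = "\<Union>{F. F \<subseteq> polynomial_maps n \<and> zero_locus n F \<in> \<Z>}"
  have "?H \<subseteq> polynomial_maps n" by auto
  moreover have "complex_space n \<inter> \<Inter>\<Z> = zero_locus n ?H"
  proof (intro equalityI subsetI)
    fix x assume "x \<in> complex_space n \<inter> \<Inter>\<Z>"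
    then show "x \<in> zero_locus n ?H"
      by (fastforce simp: zero_locus_def)
  next
    fix x assume x: "x \<in> zero_locus n ?H"
    have "x \<in> Z" if Z: "Z \<in> \<Z>" for Z
    proof -
      obtain F where "F \<subseteq> polynomial_maps n" "Z = zero_locus n F"
        using assms[OF Z] by (auto simp: algebraic_set_def)
      with x Z show ?thesis by (auto simp: zero_locus_def)
    qed
    with x show "x \<in> complex_space n \<inter> \<Inter>\<Z>" by (auto simp: zero_locus_def)
  qed
  ultimately show ?thesis by (auto simp: algebraic_set_def)
qed

lemma openin_zariski_topology:
  "openin (zariski_topology n) U \<longleftrightarrow>
     U \<subseteq> complex_space n \<and> algebraic_set n (complex_space n - U)"
proof -
  have "istopology (\<lambda>U. U \<subseteq> complex_space n \<and> algebraic_set n (complex_space n - U))"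
    unfolding istopology_def
  proof (intro conjI allI impI)
    fix S T
    assume *: "S \<subseteq> complex_space n \<and> algebraic_set n (complex_space n - S)"
      "T \<subseteq> complex_space n \<and> algebraic_set n (complex_space n - T)"
    then show "S \<inter> T \<subseteq> complex_space n" by auto
    show "algebraic_set n (complex_space n - S \<inter> T)"
      using algebraic_set_Un[of n "complex_space n - S" "complex_space n - T"] *
      by (simp add: Diff_Int)
  next
    fix \<K>
    assume *: "\<forall>K\<in>\<K>. K \<subseteq> complex_space n \<and> algebraic_set n (complex_space n - K)"
    then show "\<Union>\<K> \<subseteq> complex_space n" by auto
    have "complex_space n - \<Union>\<K> = complex_space n \<inter> \<Inter>((\<lambda>K. complex_space n - K) ` \<K>)"
      by auto
    moreover have "algebraic_set n (complex_space n \<inter> \<Inter>((\<lambda>K. complex_space n - K) ` \<K>))"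
      by (rule algebraic_set_Inter) (use * in blast)
    ultimately show "algebraic_set n (complex_space n - \<Union>\<K>)" by simp
  qed
  then show ?thesis
    by (simp add: zariski_topology_def)
qed

lemma topspace_zariski_topology: "topspace (zariski_topology n) = complex_space n"
proof -
  have "algebraic_set n {}"
    unfolding algebraic_set_def zero_locus_def
    by (rule exI[of _ "{\<lambda>x. 1}"]) (auto intro: polynomial_maps.const)
  then have "openin (zariski_topology n) (complex_space n)"
    by (simp add: openin_zariski_topology)
  moreover have "topspace (zariski_topology n) \<subseteq> complex_space n"
    using openin_topspace[of "zariski_topology n"] openin_zariski_topology by blast
  ultimately show ?thesis
    using openin_subset by blast
qed

lemma closedin_zariski_topology:
  "closedin (zariski_topology n) Z \<longleftrightarrow> algebraic_set n Z"
proof -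
  have "Z \<subseteq> complex_space n" if "algebraic_set n Z"
    using that by (auto simp: algebraic_set_def zero_locus_def)
  moreover have "complex_space n - (complex_space n - Z) = Z" if "Z \<subseteq> complex_space n"
    using that by blast
  ultimately show ?thesis
    unfolding closedin_def topspace_zariski_topology openin_zariski_topology
    by (metis Diff_subset)
qed


section \<open>Dimension and codimension\<close>

definition irreducible_in :: "'a topology \<Rightarrow> 'a set \<Rightarrow> bool" where
  "irreducible_in X S \<longleftrightarrow> S \<subseteq> topspace X \<and> S \<noteq> {} \<and>
     (\<forall>A B. closedin X A \<and> closedin X B \<and> S \<subseteq> A \<union> B \<longrightarrow> S \<subseteq> A \<or> S \<subseteq> B)"

definition irreducible_closed_chain :: "'a topology \<Rightarrow> nat \<Rightarrow> (nat \<Rightarrow> 'a set) \<Rightarrow> bool" where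
  "irreducible_closed_chain X k Z \<longleftrightarrow>
     (\<forall>i\<le>k. closedin X (Z i) \<and> irreducible_in X (Z i)) \<and> (\<forall>i<k. Z i \<subset> Z (Suc i))"

text \<open>
  Extended reals are used so that the empty space has dimension \<open>-\<infinity>\<close>, and hence
  the empty subset of a finite-dimensional space has codimension \<open>\<infinity>\<close>.
\<close>

definition krull_dim :: "'a topology \<Rightarrow> ereal" where
  "krull_dim X = Sup {ereal (real k) | k. \<exists>Z. irreducible_closed_chain X k Z}"

definition codim_in :: "'a topology \<Rightarrow> 'a set \<Rightarrow> ereal" where
  "codim_in X S = krull_dim X - krull_dim (subtopology X S)"

end

theory Submission
  imports Defs "HOL-Library.Function_Algebras"
begin

text \<open>
  Substituting \<open>\<lambda> = -\<alpha>\<close> shows that \<open>\<lambda> + \<alpha>\<close> divides \<open>P\<^sub>n\<close> exactly when the continuant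
  \<open>D\<^sub>n(t)\<close> of the shifted potential \<open>b = a - \<alpha>\<close> is the zero polynomial in \<open>t\<close>. The point of the
  proof is that the potentials \<open>b\<close> with \<open>D\<^sub>n = 0\<close> form a subset of a finite union of linear
  subspaces of dimension \<open>m\<close>. The constant term of \<open>D\<^sub>n\<close> is the product of the entries, so some
  entry \<open>b\<^sub>k\<close> vanishes; but then \<open>D\<^sub>n\<close> is, up to a nonzero constant and a factor \<open>t\<close>, again a
  continuant with nonzero couplings, of a path with two vertices fewer, whose potential depends
  linearly on \<open>b\<close> with one-dimensional fibres inside \<open>b\<^sub>k = 0\<close> (for an interior \<open>k\<close> the vertices
  \<open>k - 1, k, k + 1\<close> merge into one; at an end of the path the end vertex and its neighbour
  disappear).
  Induction on \<open>m\<close> gives \<open>vanishing_continuant_covered_by_frames\<close>. Shifting back by \<open>\<alpha>\<close> adds one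
  dimension, so the set \<open>S\<close> of potentials with a constant branch lies in a finite union of linear
  subspaces of dimension \<open>m + 1\<close>. Conversely \<open>S\<close> contains the linear subspace of dimension
  \<open>m + 1\<close> on which all odd-indexed entries agree: after the shift they vanish, and a matching of
  the path cannot cover the \<open>m + 1\<close> odd vertices with only \<open>m\<close> even ones.

  These linear statements become statements about Krull dimension as follows. For the upper bound
  (\<open>krull_dim_le_frame_size\<close>), a chain \<open>Z\<^sub>0 \<subset> \<dots> \<subset> Z\<^sub>k\<close> of irreducible closed sets
  provides polynomials \<open>f\<^sub>i\<close> that vanish on \<open>Z\<^sub>i\<close> but not on \<open>Z\<^sub>i\<^sub>+\<^sub>1\<close>, and these are
  algebraically independent on \<open>Z\<^sub>k\<close>. On a finite union of images of \<open>\<complex>\<^sup>d\<close> under linear maps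
  more than \<open>d\<close> polynomials are algebraically dependent, because there are more monomials in them
  than monomials in the \<open>d\<close> parameters. For the lower bound (\<open>krull_dim_ge_coordinate_flag\<close>), sets
  closed under affine lines are irreducible, so flags of linear subspaces are chains. Both bounds
  also give that \<open>\<complex>\<^sup>n\<close> itself has dimension \<open>n\<close>.
\<close>

section \<open>More unknowns than equations\<close>

text \<open>
  Gaussian elimination, one equation at a time: an unknown that occurs in the equation is solved
  for and substituted into the others.
\<close>

lemma homogeneous_system_nontrivial_solution:
  fixes M :: "'e \<Rightarrow> 'b \<Rightarrow> 'a::field"
  assumes "finite B" "finite E" "card B < card E"
  shows "\<exists>w. (\<exists>e\<in>E. w e \<noteq> 0) \<and> (\<forall>b\<in>B. (\<Sum>e\<in>E. w e * M e b) = 0)"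
  using assms
proof (induction B arbitrary: E M rule: finite_induct)
  case empty
  then have "E \<noteq> {}" by auto
  then show ?case by (intro exI[of _ "\<lambda>_. 1"]) auto
next
  case (insert b0 B)
  show ?case
  proof (cases "\<forall>e\<in>E. M e b0 = 0")
    case True
    have "card B < card E" using insert by simp
    then obtain w where "\<exists>e\<in>E. w e \<noteq> 0" "\<forall>b\<in>B. (\<Sum>e\<in>E. w e * M e b) = 0"
      using insert.IH[of E M] insert.prems by blast
    with True show ?thesis by (intro exI[of _ w]) auto
  next
    case False
    then obtain e0 where e0: "e0 \<in> E" "M e0 b0 \<noteq> 0" by blast
    define M' where "M' e b = M e b - M e b0 / M e0 b0 * M e0 b" for e b
    have "card B < card (E - {e0})" using insert e0 by simp
    then obtain w where w: "\<exists>e\<in>E - {e0}. w e \<noteq> 0"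
        "\<forall>b\<in>B. (\<Sum>e\<in>E - {e0}. w e * M' e b) = 0"
      using insert.IH[of "E - {e0}" M'] insert.prems by blast
    define w0 where "w0 = - (\<Sum>e\<in>E - {e0}. w e * (M e b0 / M e0 b0))"
    define v where "v = w(e0 := w0)"
    have eq: "(\<Sum>e\<in>E. v e * M e b) = (\<Sum>e\<in>E - {e0}. w e * M' e b)" for b
    proof -
      have "(\<Sum>e\<in>E. v e * M e b) = w0 * M e0 b + (\<Sum>e\<in>E - {e0}. v e * M e b)"
        using e0 insert.prems by (simp add: sum.remove[of E e0] v_def)
      also have "(\<Sum>e\<in>E - {e0}. v e * M e b) = (\<Sum>e\<in>E - {e0}. w e * M e b)"
        by (intro sum.cong) (auto simp: v_def)
      also have "w0 * M e0 b + \<dots> = (\<Sum>e\<in>E - {e0}. w e * M' e b)"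
        by (simp add: w0_def M'_def sum_distrib_left sum_distrib_right sum_subtractf algebra_simps)
      finally show ?thesis .
    qed
    have "M' e b0 = 0" for e using e0 by (simp add: M'_def)
    then have "\<forall>b\<in>insert b0 B. (\<Sum>e\<in>E. v e * M e b) = 0"
      using w(2) by (auto simp: eq)
    moreover have "\<exists>e\<in>E. v e \<noteq> 0" using w(1) by (auto simp: v_def)
    ultimately show ?thesis by blast
  qed
qed

section \<open>Flags of irreducible sets give independent polynomials\<close>

text \<open>
  Each exponent is bounded separately, rather than the total degree: a box of exponents is easy to
  count and splits off its last coordinate.
\<close>

definition exponents :: "nat \<Rightarrow> nat \<Rightarrow> (nat \<Rightarrow> nat) set" where
  "exponents k N = {..<k} \<rightarrow>\<^sub>E {..N}"

lemma finite_exponents: "finite (exponents k N)"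
  by (auto simp: exponents_def intro: finite_PiE)

lemma card_exponents: "card (exponents k N) = (N + 1) ^ k"
  by (simp add: exponents_def card_PiE)

lemma sum_exponents_Suc:
  "(\<Sum>e\<in>exponents (Suc k) N. h e) = (\<Sum>j\<le>N. \<Sum>e\<in>exponents k N. h (e(k := j)))"
proof -
  have img: "exponents (Suc k) N = (\<lambda>(j, e). e(k := j)) ` ({..N} \<times> exponents k N)"
    unfolding exponents_def lessThan_Suc by (simp add: PiE_insert_eq)
  have inj: "inj_on (\<lambda>(j, e). e(k := j)) ({..N} \<times> exponents k N)"
    unfolding exponents_def using inj_combinator[of k "{..<k}" "\<lambda>_. {..N}"] by simp
  show ?thesis
    unfolding img sum.reindex[OF inj] by (simp add: sum.cartesian_product split_def)
qed

lemma polynomial_maps_sum: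
  assumes "finite I" "\<And>i. i \<in> I \<Longrightarrow> f i \<in> polynomial_maps n"
  shows "(\<lambda>x. \<Sum>i\<in>I. f i x) \<in> polynomial_maps n"
  using assms
  by (induction I rule: finite_induct) (auto intro: polynomial_maps.intros)

lemma polynomial_maps_power:
  assumes "f \<in> polynomial_maps n"
  shows "(\<lambda>x. f x ^ j) \<in> polynomial_maps n"
  using assms by (induction j) (auto intro: polynomial_maps.intros)

lemma polynomial_maps_prod:
  assumes "finite I" "\<And>i. i \<in> I \<Longrightarrow> f i \<in> polynomial_maps n"
  shows "(\<lambda>x. \<Prod>i\<in>I. f i x) \<in> polynomial_maps n"
  using assms
  by (induction I rule: finite_induct) (auto intro: polynomial_maps.intros)

text \<open>
  Why the \<open>f i\<close> are algebraically independent on the largest set: sort a relation by powers of the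
  last function \<open>f k\<close>, with coefficients \<open>g j\<close> that are polynomials in the other functions. On the
  set \<open>Z k\<close> of the induction hypothesis \<open>f k\<close> vanishes, so the lowest coefficient vanishes there
  and, by induction, identically. As \<open>f k\<close> is a nonzero function on the irreducible set
  \<open>Z (Suc k)\<close>, it can be cancelled from what remains, and the next coefficient becomes the
  lowest one. The hypothesis \<open>prime\<close> expresses irreducibility.
\<close>

lemma flag_monomials_independent:
  fixes f :: "nat \<Rightarrow> (nat \<Rightarrow> complex) \<Rightarrow> complex" and Z :: "nat \<Rightarrow> (nat \<Rightarrow> complex) set"
  assumes nonempty: "Z 0 \<noteq> {}"
    and mono: "\<And>i. i < k \<Longrightarrow> Z i \<subseteq> Z (Suc i)"
    and poly: "\<And>i. i < k \<Longrightarrow> f i \<in> polynomial_maps n"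
    and vanish: "\<And>i x. i < k \<Longrightarrow> x \<in> Z i \<Longrightarrow> f i x = 0"
    and nonzero: "\<And>i. i < k \<Longrightarrow> \<exists>x\<in>Z (Suc i). f i x \<noteq> 0"
    and prime: "\<And>i g h. i < k \<Longrightarrow> g \<in> polynomial_maps n \<Longrightarrow> h \<in> polynomial_maps n \<Longrightarrow>
       \<forall>x\<in>Z (Suc i). g x * h x = 0 \<Longrightarrow> (\<forall>x\<in>Z (Suc i). g x = 0) \<or> (\<forall>x\<in>Z (Suc i). h x = 0)"
    and relation: "\<forall>x\<in>Z k. (\<Sum>e\<in>exponents k N. w e * (\<Prod>i<k. f i x ^ e i)) = 0"
  shows "\<forall>e\<in>exponents k N. w e = 0"
  using assms
proof (induction k arbitrary: w)
  case 0
  then show ?case by (auto simp: exponents_def)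
next
  case (Suc k)
  define g where "g j x = (\<Sum>e\<in>exponents k N. w (e(k := j)) * (\<Prod>i<k. f i x ^ e i))" for j x
  have g_poly: "g j \<in> polynomial_maps n" for j
    unfolding g_def using Suc.prems(3)
    by (intro polynomial_maps_sum polynomial_maps_prod polynomial_maps_power
        polynomial_maps.mult polynomial_maps.const finite_exponents) auto
  have rel: "(\<Sum>j\<le>N. g j x * f k x ^ j) = 0" if "x \<in> Z (Suc k)" for x
  proof -
    have "(\<Sum>e\<in>exponents (Suc k) N. w e * (\<Prod>i<Suc k. f i x ^ e i)) = 0"
      using Suc.prems(7) that by blast
    then show ?thesis
      by (simp add: sum_exponents_Suc g_def sum_distrib_left sum_distrib_right mult_ac)
  qed
  have IH: "\<forall>e\<in>exponents k N. w (e(k := j)) = 0" if "\<forall>x\<in>Z k. g j x = 0" for j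
  proof (rule Suc.IH)
    show "\<forall>x\<in>Z k. (\<Sum>e\<in>exponents k N. w (e(k := j)) * (\<Prod>i<k. f i x ^ e i)) = 0"
      using that by (simp add: g_def)
  qed (use Suc.prems(1-6) in \<open>simp_all add: less_SucI\<close>)
  have coeff: "\<forall>e\<in>exponents k N. w (e(k := j)) = 0" if "j \<le> N" for j
    using that
  proof (induction j rule: less_induct)
    case (less j)
    have low: "g i x = 0" if "i < j" for i x
    proof -
      have "\<forall>e\<in>exponents k N. w (e(k := i)) = 0"
        by (rule less.IH) (use that less.prems in auto)
      then show ?thesis unfolding g_def by (intro sum.neutral ballI) (simp only: mult_zero_left)
    qed
    \<comment> \<open>The relation after the coefficients below \<open>j\<close> are dropped and \<open>f k ^ j\<close> is cancelled.\<close>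
    define q where "q x = (\<Sum>i = j..N. g i x * f k x ^ (i - j))" for x
    have q_poly: "q \<in> polynomial_maps n"
      unfolding q_def
      by (intro polynomial_maps_sum polynomial_maps.mult polynomial_maps_power g_poly
          Suc.prems(3)) auto
    have "f k x ^ j * q x = 0" if "x \<in> Z (Suc k)" for x
    proof -
      have "f k x ^ j * q x = (\<Sum>i = j..N. g i x * f k x ^ i)"
        unfolding q_def sum_distrib_left
        by (intro sum.cong) (auto simp: power_add[symmetric] mult.left_commute)
      also have "\<dots> = (\<Sum>i\<le>N. g i x * f k x ^ i)"
        by (intro sum.mono_neutral_left) (auto simp: low)
      finally show ?thesis using rel[OF that] by simp
    qed
    then have "(\<forall>x\<in>Z (Suc k). f k x ^ j = 0) \<or> (\<forall>x\<in>Z (Suc k). q x = 0)"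
      by (intro Suc.prems(6) q_poly polynomial_maps_power Suc.prems(3)) auto
    moreover have "\<not> (\<forall>x\<in>Z (Suc k). f k x ^ j = 0)"
      using Suc.prems(5)[of k] by auto
    ultimately have q0: "\<forall>x\<in>Z (Suc k). q x = 0" by blast
    have "g j x = 0" if "x \<in> Z k" for x
    proof -
      have "x \<in> Z (Suc k)" using that Suc.prems(2)[of k] by auto
      then have "0 = q x" using q0 by simp
      also have "q x = (\<Sum>i = j..N. if i = j then g i x else 0)"
        unfolding q_def using Suc.prems(4)[of k x] that
        by (intro sum.cong) (auto simp: power_0_left)
      also have "\<dots> = g j x" using less.prems by simp
      finally show ?thesis by simp
    qed
    then show ?case by (intro IH) blast
  qed
  show ?case
  proof
    fix e assume e: "e \<in> exponents (Suc k) N"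
    define e' where "e' = restrict e {..<k}"
    have "e' \<in> exponents k N" "e k \<le> N" "e = e'(k := e k)"
      using e by (auto simp: exponents_def e'_def PiE_iff extensional_def fun_eq_iff)
    then show "w e = 0" using coeff by metis
  qed
qed

section \<open>Polynomials of bounded degree in linear parameters\<close>

interpretation function_space: vector_space
  "\<lambda>(z::complex) (g :: (nat \<Rightarrow> complex) \<Rightarrow> complex) x. z * g x"
  by unfold_locales (auto simp: fun_eq_iff algebra_simps)

definition monomials :: "nat \<Rightarrow> nat \<Rightarrow> ((nat \<Rightarrow> complex) \<Rightarrow> complex) set" where
  "monomials d r = (\<lambda>e x. \<Prod>i<d. x i ^ e i) ` exponents d r"

abbreviation polys_upto :: "nat \<Rightarrow> nat \<Rightarrow> ((nat \<Rightarrow> complex) \<Rightarrow> complex) set" where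
  "polys_upto d r \<equiv> function_space.span (monomials d r)"

lemma finite_monomials: "finite (monomials d r)"
  by (simp add: monomials_def finite_exponents)

lemma card_monomials_le: "card (monomials d r) \<le> (r + 1) ^ d"
  unfolding monomials_def using card_image_le[OF finite_exponents] by (metis card_exponents)

lemma polys_upto_mono: "r \<le> s \<Longrightarrow> g \<in> polys_upto d r \<Longrightarrow> g \<in> polys_upto d s"
proof -
  assume "r \<le> s"
  then have "exponents d r \<subseteq> exponents d s"
    unfolding exponents_def by (intro PiE_mono) auto
  then have "polys_upto d r \<subseteq> polys_upto d s"
    unfolding monomials_def by (intro function_space.span_mono image_mono)
  then show "g \<in> polys_upto d r \<Longrightarrow> g \<in> polys_upto d s" by blast
qed

lemma monomial_in_polys_upto:
  assumes "\<And>i. i < d \<Longrightarrow> e i \<le> r"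
  shows "(\<lambda>x. \<Prod>i<d. x i ^ e i) \<in> polys_upto d r"
proof -
  have "(\<lambda>x. \<Prod>i<d. x i ^ e i :: complex) = (\<lambda>x. \<Prod>i<d. x i ^ restrict e {..<d} i)"
    by (intro ext prod.cong) auto
  moreover have "restrict e {..<d} \<in> exponents d r"
    using assms by (auto simp: exponents_def)
  ultimately have "(\<lambda>x. \<Prod>i<d. x i ^ e i) \<in> monomials d r"
    unfolding monomials_def by blast
  then show ?thesis by (rule function_space.span_base)
qed

text \<open>
  Bilinearity reduces this to two monomials, by one induction over the span for each factor.
\<close>

lemma polys_upto_mult:
  assumes "g \<in> polys_upto d r" "h \<in> polys_upto d s"
  shows "(\<lambda>x. g x * h x) \<in> polys_upto d (r + s)"
  using assms(1)
proof (induction rule: function_space.span_induct)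
  case base
  show ?case
  proof (rule function_space.subspaceI)
    show "0 \<in> {g. (\<lambda>x. g x * h x) \<in> polys_upto d (r + s)}"
      using function_space.span_zero[of "monomials d (r + s)"] by (simp add: zero_fun_def)
  next
    fix f g assume "f \<in> {g. (\<lambda>x. g x * h x) \<in> polys_upto d (r + s)}"
      "g \<in> {g. (\<lambda>x. g x * h x) \<in> polys_upto d (r + s)}"
    then show "f + g \<in> {g. (\<lambda>x. g x * h x) \<in> polys_upto d (r + s)}"
      using function_space.span_add[of "\<lambda>x. f x * h x" "monomials d (r + s)" "\<lambda>x. g x * h x"]
      by (simp add: plus_fun_def distrib_right)
  next
    fix z g assume "g \<in> {g. (\<lambda>x. g x * h x) \<in> polys_upto d (r + s)}"
    then show "(\<lambda>x. z * g x) \<in> {g. (\<lambda>x. g x * h x) \<in> polys_upto d (r + s)}"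
      using function_space.span_scale[of "\<lambda>x. g x * h x" "monomials d (r + s)" z]
      by (simp add: mult.assoc)
  qed
next
  case (step g)
  then obtain e where e: "e \<in> exponents d r" "g = (\<lambda>x. \<Prod>i<d. x i ^ e i)"
    by (auto simp: monomials_def)
  show ?case
    using assms(2)
  proof (induction rule: function_space.span_induct)
    case base
    show ?case
    proof (rule function_space.subspaceI)
      show "0 \<in> {h. (\<lambda>x. g x * h x) \<in> polys_upto d (r + s)}"
        using function_space.span_zero[of "monomials d (r + s)"] by (simp add: zero_fun_def)
    next
      fix f h assume "f \<in> {h. (\<lambda>x. g x * h x) \<in> polys_upto d (r + s)}"
        "h \<in> {h. (\<lambda>x. g x * h x) \<in> polys_upto d (r + s)}"
      then show "f + h \<in> {h. (\<lambda>x. g x * h x) \<in> polys_upto d (r + s)}"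
        using function_space.span_add[of "\<lambda>x. g x * f x" "monomials d (r + s)" "\<lambda>x. g x * h x"]
        by (simp add: plus_fun_def distrib_left)
    next
      fix z h assume "h \<in> {h. (\<lambda>x. g x * h x) \<in> polys_upto d (r + s)}"
      then show "(\<lambda>x. z * h x) \<in> {h. (\<lambda>x. g x * h x) \<in> polys_upto d (r + s)}"
        using function_space.span_scale[of "\<lambda>x. g x * h x" "monomials d (r + s)" z]
        by (simp add: mult.left_commute)
    qed
  next
    case (step h)
    then obtain e' where e': "e' \<in> exponents d s" "h = (\<lambda>x. \<Prod>i<d. x i ^ e' i)"
      by (auto simp: monomials_def)
    have "(\<lambda>x. \<Prod>i<d. x i ^ (e i + e' i)) \<in> polys_upto d (r + s)"
      using e(1) e'(1) by (intro monomial_in_polys_upto add_mono) (auto simp: exponents_def)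
    then show ?case by (simp add: e(2) e'(2) power_add prod.distrib)
  qed
qed

lemma polys_upto_const: "(\<lambda>x. z) \<in> polys_upto d r"
  using function_space.span_scale[OF monomial_in_polys_upto[of d "\<lambda>_. 0" r], of z] by simp

lemma polys_upto_power:
  assumes "g \<in> polys_upto d r"
  shows "(\<lambda>x. g x ^ j) \<in> polys_upto d (j * r)"
proof (induction j)
  case 0
  then show ?case by (simp add: polys_upto_const)
next
  case (Suc j)
  then show ?case using polys_upto_mult[OF assms Suc] by simp
qed

lemma polys_upto_prod:
  assumes "\<And>i. i < k \<Longrightarrow> g i \<in> polys_upto d r"
  shows "(\<lambda>x. \<Prod>i<k. g i x) \<in> polys_upto d (k * r)"
  using assms
proof (induction k)
  case 0
  then show ?case by (simp add: polys_upto_const)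
next
  case (Suc k)
  then show ?case using polys_upto_mult[of "g k" d r "\<lambda>x. \<Prod>i<k. g i x" "k * r"]
    by (simp add: mult.commute)
qed

text \<open>
  The linear parametrization by \<open>\<complex>\<^sup>d\<close> of the span of the vectors \<open>u 0, \<dots>, u (d - 1)\<close>. The
  restriction makes the value a point of \<^term>\<open>complex_space n\<close>.
\<close>

definition frame_map :: "nat \<Rightarrow> nat \<Rightarrow> (nat \<Rightarrow> nat \<Rightarrow> complex) \<Rightarrow> (nat \<Rightarrow> complex) \<Rightarrow> nat \<Rightarrow> complex" where
  "frame_map n d u x = (\<lambda>i\<in>{1..n}. \<Sum>j<d. x j * u j i)"

lemma coordinate_in_polys_upto:
  assumes "j < d"
  shows "(\<lambda>x. x j) \<in> polys_upto d 1"
proof -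
  have "(\<lambda>x. \<Prod>i<d. x i ^ (if i = j then 1 else 0)) \<in> polys_upto d 1"
    by (intro monomial_in_polys_upto) auto
  moreover have "(\<Prod>i<d. x i ^ (if i = j then 1 else 0)) = x j" for x :: "nat \<Rightarrow> complex"
  proof -
    have "(\<Prod>i<d. x i ^ (if i = j then 1 else 0)) = (\<Prod>i<d. if i = j then x i else 1)"
      by (intro prod.cong) auto
    then show ?thesis using assms by simp
  qed
  ultimately show ?thesis by simp
qed

lemma sum_apply: "(\<Sum>i\<in>I. F i) x = (\<Sum>i\<in>I. F i x)"
  by (induction I rule: infinite_finite_induct) auto

lemma polynomial_map_on_frame:
  assumes "f \<in> polynomial_maps n"
  shows "\<exists>r. (\<lambda>x. f (frame_map n d u x)) \<in> polys_upto d r"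
  using assms
proof induction
  case (const z)
  show ?case using polys_upto_const by blast
next
  case (coord i)
  have "(\<Sum>j<d. (\<lambda>x. u j i * x j)) \<in> polys_upto d 1"
    by (intro function_space.span_sum function_space.span_scale coordinate_in_polys_upto) auto
  moreover have "(\<Sum>j<d. (\<lambda>x. u j i * x j)) = (\<lambda>x. frame_map n d u x i)"
    using coord by (auto simp: frame_map_def fun_eq_iff sum_apply mult.commute)
  ultimately show ?case by auto
next
  case (add f g)
  then obtain r s where rs: "(\<lambda>x. f (frame_map n d u x)) \<in> polys_upto d r"
    "(\<lambda>x. g (frame_map n d u x)) \<in> polys_upto d s" by blast
  have "(\<lambda>x. f (frame_map n d u x)) + (\<lambda>x. g (frame_map n d u x)) \<in> polys_upto d (max r s)"
    using rs by (intro function_space.span_add) (auto intro: polys_upto_mono[rotated])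
  then show ?case by (auto simp: plus_fun_def)
next
  case (mult f g)
  then show ?case using polys_upto_mult by blast
qed

lemma polynomial_maps_on_frames_common_degree:
  fixes k :: nat
  assumes "finite U" "\<And>i. i < k \<Longrightarrow> f i \<in> polynomial_maps n"
  shows "\<exists>D. \<forall>u\<in>U. \<forall>i<k. (\<lambda>x. f i (frame_map n d u x)) \<in> polys_upto d D"
proof -
  have "\<forall>u i. \<exists>r. i < k \<longrightarrow> (\<lambda>x. f i (frame_map n d u x)) \<in> polys_upto d r"
    using polynomial_map_on_frame assms(2) by blast
  then obtain r where r: "\<And>u i. i < k \<Longrightarrow> (\<lambda>x. f i (frame_map n d u x)) \<in> polys_upto d (r u i)"
    by metis
  show ?thesis
  proof (intro exI ballI allI impI)
    fix u i assume "u \<in> U" "i < k"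
    have "r u i \<le> (\<Sum>i<k. r u i)"
      using \<open>i < k\<close> by (intro member_le_sum[of i "{..<k}" "r u"]) auto
    moreover have "(\<Sum>i<k. r u i) \<le> (\<Sum>u\<in>U. \<Sum>i<k. r u i)"
      using assms(1) \<open>u \<in> U\<close> by (intro member_le_sum[of u U "\<lambda>u. \<Sum>i<k. r u i"]) auto
    ultimately have "r u i \<le> (\<Sum>u\<in>U. \<Sum>i<k. r u i)" by linarith
    then show "(\<lambda>x. f i (frame_map n d u x)) \<in> polys_upto d (\<Sum>u\<in>U. \<Sum>i<k. r u i)"
      using r \<open>i < k\<close> polys_upto_mono by blast
  qed
qed

text \<open>
  A count. Let \<open>D\<close> bound the degree of the \<open>f i\<close> in each parameter. There are \<open>(N + 1) ^ k\<close>
  monomials in the \<open>f i\<close> with exponents up to \<open>N\<close>. In the parameters of a single frame they are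
  polynomials of degree at most \<open>k * N * D\<close> in each parameter, so a relation among them on
  all frames is a solution of at most \<open>card U * (k * N * D + 1) ^ d\<close> linear equations. For large \<open>N\<close> this is smaller than the number of monomials, since \<open>d < k\<close>. The frames are treated simultaneously, so that the
  union they cover need not be decomposed into its components.
\<close>

lemma frames_algebraic_dependence:
  assumes "finite U" and cover: "\<And>a. a \<in> S \<Longrightarrow> \<exists>u\<in>U. \<exists>x. a = frame_map n d u x"
    and f: "\<And>i. i < k \<Longrightarrow> f i \<in> polynomial_maps n" and "d < k"
  shows "\<exists>N w. (\<exists>e\<in>exponents k N. w e \<noteq> 0) \<and>
           (\<forall>a\<in>S. (\<Sum>e\<in>exponents k N. w e * (\<Prod>i<k. f i a ^ e i)) = 0)"
proof -
  obtain D where D: "\<And>u i. u \<in> U \<Longrightarrow> i < k \<Longrightarrow> (\<lambda>x. f i (frame_map n d u x)) \<in> polys_upto d D"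
    using polynomial_maps_on_frames_common_degree[OF assms(1), of k f n d] f by blast
  \<comment> \<open>Just large enough for \<open>card U * (k * D + 1) ^ d < N + 1\<close>.\<close>
  define N where "N = card U * (k * D + 1) ^ d"
  define R where "R = k * (N * D)"
  define F where "F u e x = (\<Prod>i<k. f i (frame_map n d u x) ^ e i)" for u e x
  have F: "F u e \<in> polys_upto d R" if "u \<in> U" "e \<in> exponents k N" for u e
    unfolding F_def R_def
  proof (rule polys_upto_prod)
    fix i assume i: "i < k"
    then have "e i \<le> N" using that(2) by (auto simp: exponents_def)
    then show "(\<lambda>x. f i (frame_map n d u x) ^ e i) \<in> polys_upto d (N * D)"
      by (intro polys_upto_mono[OF _ polys_upto_power[OF D[OF that(1) i]]] mult_right_mono) auto
  qed
  define q where "q u e = (SOME q. F u e = (\<Sum>v\<in>monomials d R. (\<lambda>x. q v * v x)))" for u e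
  have q: "F u e = (\<Sum>v\<in>monomials d R. (\<lambda>x. q u e v * v x))"
    if "u \<in> U" "e \<in> exponents k N" for u e
  proof -
    have "F u e \<in> range (\<lambda>q. \<Sum>v\<in>monomials d R. (\<lambda>x. q v * v x))"
      using F[OF that] by (simp only: function_space.span_finite[OF finite_monomials])
    then have "\<exists>q. F u e = (\<Sum>v\<in>monomials d R. (\<lambda>x. q v * v x))"
      by (rule rangeE) (rule exI)
    then show ?thesis unfolding q_def by (rule someI_ex)
  qed
  have less: "card (U \<times> monomials d R) < card (exponents k N)"
  proof -
    have "card (U \<times> monomials d R) \<le> card U * (R + 1) ^ d"
      unfolding card_cartesian_product by (intro mult_left_mono card_monomials_le) simp
    also have "(R + 1) ^ d \<le> ((k * D + 1) * (N + 1)) ^ d"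
      by (intro power_mono) (auto simp: R_def algebra_simps)
    also have "card U * ((k * D + 1) * (N + 1)) ^ d = card U * (k * D + 1) ^ d * (N + 1) ^ d"
      by (simp only: power_mult_distrib mult.assoc)
    also have "\<dots> = N * (N + 1) ^ d"
      by (simp only: N_def)
    also have "\<dots> < (N + 1) ^ Suc d" by simp
    also have "\<dots> \<le> (N + 1) ^ k" using \<open>d < k\<close> by (intro power_increasing) auto
    finally show ?thesis by (simp add: card_exponents)
  qed
  have "finite (U \<times> monomials d R)" using assms(1) finite_monomials by blast
  from homogeneous_system_nontrivial_solution[OF this finite_exponents less,
      where M = "\<lambda>e b. q (fst b) e (snd b)"]
  obtain w where w: "\<exists>e\<in>exponents k N. w e \<noteq> 0"
    "\<forall>b\<in>U \<times> monomials d R. (\<Sum>e\<in>exponents k N. w e * q (fst b) e (snd b)) = 0"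
    by (elim exE conjE) (rule that)
  have "(\<Sum>e\<in>exponents k N. w e * (\<Prod>i<k. f i a ^ e i)) = 0" if "a \<in> S" for a
  proof -
    obtain u x where u: "u \<in> U" and a: "a = frame_map n d u x"
      using cover[OF \<open>a \<in> S\<close>] by blast
    have "(\<Sum>e\<in>exponents k N. w e * (\<Prod>i<k. f i a ^ e i)) = (\<Sum>e\<in>exponents k N. w e * F u e x)"
      by (simp add: F_def a)
    also have "\<dots> = (\<Sum>e\<in>exponents k N. \<Sum>v\<in>monomials d R. w e * q u e v * v x)"
      by (intro sum.cong refl) (simp add: q[OF u] sum_apply sum_distrib_left mult.assoc)
    also have "\<dots> = (\<Sum>v\<in>monomials d R. (\<Sum>e\<in>exponents k N. w e * q u e v) * v x)"
      by (subst sum.swap) (simp add: sum_distrib_right)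
    also have "\<dots> = 0" using w(2) u by (intro sum.neutral) auto
    finally show ?thesis .
  qed
  with w(1) show ?thesis by blast
qed

section \<open>Krull dimension from above\<close>

lemma closedin_zero_set:
  assumes "g \<in> polynomial_maps n"
  shows "closedin (zariski_topology n) {x \<in> complex_space n. g x = 0}"
  unfolding closedin_zariski_topology algebraic_set_def
  using assms by (intro exI[of _ "{g}"]) (auto simp: zero_locus_def)

lemma irreducible_prime:
  assumes "S \<subseteq> complex_space n" and irr: "irreducible_in (subtopology (zariski_topology n) S) Z"
    and gh: "g \<in> polynomial_maps n" "h \<in> polynomial_maps n" "\<forall>x\<in>Z. g x * h x = 0"
  shows "(\<forall>x\<in>Z. g x = 0) \<or> (\<forall>x\<in>Z. h x = 0)"
proof -
  let ?X = "subtopology (zariski_topology n) S"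
  have ZS: "Z \<subseteq> S" using irr by (simp add: irreducible_in_def)
  let ?V = "\<lambda>g. S \<inter> {x \<in> complex_space n. g x = 0}"
  have "closedin ?X (?V g)" "closedin ?X (?V h)"
    using closedin_zero_set gh(1,2) by (auto simp: closedin_subtopology_Int_closed)
  moreover have "Z \<subseteq> ?V g \<union> ?V h" using ZS assms(1) gh(3) by auto
  ultimately have "Z \<subseteq> ?V g \<or> Z \<subseteq> ?V h" using irr unfolding irreducible_in_def by blast
  then show ?thesis by auto
qed

lemma closed_separated_by_polynomial:
  assumes "S \<subseteq> complex_space n" "closedin (subtopology (zariski_topology n) S) Z"
    and "Z \<subset> W" "W \<subseteq> S"
  shows "\<exists>f\<in>polynomial_maps n. (\<forall>x\<in>Z. f x = 0) \<and> (\<exists>x\<in>W. f x \<noteq> 0)"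
proof -
  obtain F where F: "F \<subseteq> polynomial_maps n" "Z = zero_locus n F \<inter> S"
    using assms(2) unfolding closedin_subtopology closedin_zariski_topology algebraic_set_def by blast
  obtain x where x: "x \<in> W" "x \<notin> Z" using assms(3) by blast
  then have "x \<in> complex_space n" "x \<in> S" using assms by auto
  then obtain f where "f \<in> F" "f x \<noteq> 0" using x F by (auto simp: zero_locus_def)
  then show ?thesis using F x by (intro bexI[of _ f]) (auto simp: zero_locus_def)
qed

text \<open>
  Along a chain of length \<open>k\<close>, choose for each set a polynomial that vanishes on it but not on the
  next one. These \<open>k\<close> polynomials satisfy no algebraic relation on the largest set of the chain. If
  \<open>k > d\<close> they do satisfy one on all of \<open>S\<close>, and it restricts to every subset.
\<close>

lemma krull_dim_le_frame_size:
  assumes S: "S \<subseteq> complex_space n"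
    and "finite U" and cover: "\<And>a. a \<in> S \<Longrightarrow> \<exists>u\<in>U. \<exists>x. a = frame_map n d u x"
  shows "krull_dim (subtopology (zariski_topology n) S) \<le> ereal (real d)"
  unfolding krull_dim_def
proof (rule Sup_least, clarify)
  let ?X = "subtopology (zariski_topology n) S"
  fix k Z assume "irreducible_closed_chain ?X k Z"
  then have closed: "\<And>i. i \<le> k \<Longrightarrow> closedin ?X (Z i)"
    and irr: "\<And>i. i \<le> k \<Longrightarrow> irreducible_in ?X (Z i)" and strict: "\<And>i. i < k \<Longrightarrow> Z i \<subset> Z (Suc i)"
    by (auto simp: irreducible_closed_chain_def)
  have ZS: "Z i \<subseteq> S" if "i \<le> k" for i using irr[OF that] by (simp add: irreducible_in_def)
  have "\<forall>i. \<exists>f. i < k \<longrightarrow> f \<in> polynomial_maps n \<and> (\<forall>x\<in>Z i. f x = 0) \<and> (\<exists>x\<in>Z (Suc i). f x \<noteq> 0)"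
  proof
    fix i show "\<exists>f. i < k \<longrightarrow> f \<in> polynomial_maps n \<and> (\<forall>x\<in>Z i. f x = 0) \<and> (\<exists>x\<in>Z (Suc i). f x \<noteq> 0)"
      using closed_separated_by_polynomial[OF S closed[of i] strict[of i] ZS[of "Suc i"]]
      by (cases "i < k") auto
  qed
  then obtain f where f: "\<And>i. i < k \<Longrightarrow> f i \<in> polynomial_maps n"
    "\<And>i x. i < k \<Longrightarrow> x \<in> Z i \<Longrightarrow> f i x = 0" "\<And>i. i < k \<Longrightarrow> \<exists>x\<in>Z (Suc i). f i x \<noteq> 0"
    by metis
  show "ereal (real k) \<le> ereal (real d)"
  proof (rule ccontr)
    assume "\<not> ereal (real k) \<le> ereal (real d)"
    then have "d < k" by simp
    then obtain N w where w: "\<exists>e\<in>exponents k N. w e \<noteq> 0"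
      "\<And>a. a \<in> S \<Longrightarrow> (\<Sum>e\<in>exponents k N. w e * (\<Prod>i<k. f i a ^ e i)) = 0"
      using frames_algebraic_dependence[of U S n d k f] assms(2) cover f(1) by blast
    have "\<forall>e\<in>exponents k N. w e = 0"
    proof (rule flag_monomials_independent[of Z k f n])
      show "Z 0 \<noteq> {}" using irr[of 0] by (simp add: irreducible_in_def)
      show "\<forall>x\<in>Z k. (\<Sum>e\<in>exponents k N. w e * (\<Prod>i<k. f i x ^ e i)) = 0"
        using w(2) ZS[of k] by blast
      show "(\<forall>x\<in>Z (Suc i). g x = 0) \<or> (\<forall>x\<in>Z (Suc i). h x = 0)"
        if "i < k" "g \<in> polynomial_maps n" "h \<in> polynomial_maps n"
          "\<forall>x\<in>Z (Suc i). g x * h x = 0" for i g h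
        using irreducible_prime[OF S irr[of "Suc i"]] that by simp
      show "Z i \<subseteq> Z (Suc i)" if "i < k" for i using strict[OF that] by blast
    qed (use f in auto)
    with w(1) show False by blast
  qed
qed

section \<open>Krull dimension from below\<close>

lemma polynomial_map_on_line:
  assumes "f \<in> polynomial_maps n"
  shows "\<exists>p. \<forall>s. f (\<lambda>i. (1 - s) * x i + s * y i) = poly p s"
  using assms
proof induction
  case (const z)
  show ?case by (rule exI[of _ "[:z:]"]) simp
next
  case (coord i)
  show ?case by (rule exI[of _ "[:x i, y i - x i:]"]) (simp add: algebra_simps)
next
  case (add f g)
  then show ?case by (metis poly_add)
next
  case (mult f g)
  then show ?case by (metis poly_mult)
qed

text \<open>
  If neither of two closed sets covers \<open>Z\<close>, choose a point of \<open>Z\<close> outside each, and a polynomial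
  vanishing on each closed set but not at the chosen point. On the line through the two points both
  become nonzero polynomials in one variable, so their product is nonzero somewhere on the line, and
  there \<open>Z\<close> is not covered by the union.
\<close>

lemma irreducible_if_line_closed:
  assumes S: "S \<subseteq> complex_space n" and "Z \<subseteq> S" "Z \<noteq> {}"
    and line: "\<And>x y s. x \<in> Z \<Longrightarrow> y \<in> Z \<Longrightarrow> (\<lambda>i. (1 - s) * x i + s * y i) \<in> Z"
  shows "irreducible_in (subtopology (zariski_topology n) S) Z"
  unfolding irreducible_in_def
proof (intro conjI allI impI)
  let ?X = "subtopology (zariski_topology n) S"
  show "Z \<subseteq> topspace ?X" using assms by (auto simp: topspace_zariski_topology)
  show "Z \<noteq> {}" by fact
  fix A B assume AB: "closedin ?X A \<and> closedin ?X B \<and> Z \<subseteq> A \<union> B"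
  have separate: "\<exists>f\<in>polynomial_maps n. (\<forall>z\<in>C. f z = 0) \<and> f x \<noteq> 0"
    if "closedin ?X C" "x \<in> Z" "x \<notin> C" for C x
    using closed_separated_by_polynomial[OF S that(1), of "insert x C"] that assms(2)
      closedin_subset[OF that(1)] by (auto simp: topspace_zariski_topology)
  show "Z \<subseteq> A \<or> Z \<subseteq> B"
  proof (rule ccontr)
    assume "\<not> (Z \<subseteq> A \<or> Z \<subseteq> B)"
    then obtain x y where x: "x \<in> Z" "x \<notin> A" and y: "y \<in> Z" "y \<notin> B" by blast
    obtain f where f: "f \<in> polynomial_maps n" "\<forall>z\<in>A. f z = 0" "f x \<noteq> 0"
      using separate x AB by blast
    obtain g where g: "g \<in> polynomial_maps n" "\<forall>z\<in>B. g z = 0" "g y \<noteq> 0"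
      using separate y AB by blast
    obtain p where p: "\<And>s. f (\<lambda>i. (1 - s) * x i + s * y i) = poly p s"
      using polynomial_map_on_line[OF f(1)] by metis
    obtain q where q: "\<And>s. g (\<lambda>i. (1 - s) * x i + s * y i) = poly q s"
      using polynomial_map_on_line[OF g(1)] by metis
    have "poly (p * q) s = 0" for s
      using line[OF x(1) y(1), of s] AB f(2) g(2) p[of s] q[of s] by auto
    then have "p = 0 \<or> q = 0" using poly_all_0_iff_0[of "p * q"] by simp
    moreover have "p \<noteq> 0" using p[of 0] f(3) by auto
    moreover have "q \<noteq> 0" using q[of 1] g(3) by auto
    ultimately show False by blast
  qed
qed

text \<open>
  The chain consists of the subsets of \<open>L\<close> on which the coordinates \<open>\<kappa> i, \<dots>, \<kappa> (d - 1)\<close> vanish.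
  The point \<open>origin\<close> makes the smallest one nonempty, and \<open>witness\<close> makes each inclusion strict.
\<close>

lemma krull_dim_ge_coordinate_flag:
  assumes "L \<subseteq> S" "S \<subseteq> complex_space n" "algebraic_set n L"
    and line: "\<And>x y s. x \<in> L \<Longrightarrow> y \<in> L \<Longrightarrow> (\<lambda>i. (1 - s) * x i + s * y i) \<in> L"
    and \<kappa>: "\<And>i. i < d \<Longrightarrow> \<kappa> i \<in> {1..n}"
    and origin: "\<exists>x\<in>L. \<forall>i<d. x (\<kappa> i) = 0"
    and witness: "\<And>i. i < d \<Longrightarrow> \<exists>x\<in>L. x (\<kappa> i) \<noteq> 0 \<and> (\<forall>j. i < j \<and> j < d \<longrightarrow> x (\<kappa> j) = 0)"
  shows "ereal (real d) \<le> krull_dim (subtopology (zariski_topology n) S)"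
proof -
  let ?X = "subtopology (zariski_topology n) S"
  define Z where "Z i = {x \<in> L. \<forall>j. i \<le> j \<and> j < d \<longrightarrow> x (\<kappa> j) = 0}" for i
  have "irreducible_closed_chain ?X d Z"
    unfolding irreducible_closed_chain_def
  proof (intro conjI allI impI)
    fix i
    obtain F where F: "F \<subseteq> polynomial_maps n" "L = zero_locus n F"
      using assms(3) by (auto simp: algebraic_set_def)
    have "Z i = zero_locus n (F \<union> {(\<lambda>x. x (\<kappa> j)) | j. i \<le> j \<and> j < d})"
      unfolding Z_def F(2) zero_locus_def by auto
    moreover have "F \<union> {(\<lambda>x. x (\<kappa> j)) | j. i \<le> j \<and> j < d} \<subseteq> polynomial_maps n"
      using F(1) \<kappa> by (auto intro: polynomial_maps.coord)
    ultimately have "algebraic_set n (Z i)"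
      unfolding algebraic_set_def by blast
    then show "closedin ?X (Z i)"
      using assms(1) unfolding closedin_subtopology closedin_zariski_topology
      by (intro exI[of _ "Z i"]) (auto simp: Z_def)
    show "irreducible_in ?X (Z i)"
    proof (rule irreducible_if_line_closed)
      show "Z i \<noteq> {}" using origin by (auto simp: Z_def)
    qed (use assms in \<open>auto simp: Z_def\<close>)
  next
    fix i assume i: "i < d"
    obtain x where x: "x \<in> L" "x (\<kappa> i) \<noteq> 0" "\<forall>j. i < j \<and> j < d \<longrightarrow> x (\<kappa> j) = 0"
      using witness[OF i] by blast
    then have "x \<in> Z (Suc i)" "x \<notin> Z i" using i by (auto simp: Z_def)
    moreover have "Z i \<subseteq> Z (Suc i)" by (auto simp: Z_def)
    ultimately show "Z i \<subset> Z (Suc i)" by blast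
  qed
  then show ?thesis unfolding krull_dim_def by (intro Sup_upper) blast
qed

lemma krull_dim_complex_space: "krull_dim (zariski_topology n) = ereal (real n)"
proof -
  have top: "subtopology (zariski_topology n) (complex_space n) = zariski_topology n"
    using subtopology_topspace[of "zariski_topology n"] by (simp add: topspace_zariski_topology)
  have "krull_dim (subtopology (zariski_topology n) (complex_space n)) \<le> ereal (real n)"
  proof (rule krull_dim_le_frame_size[where U = "{\<lambda>j i. if i = j + 1 then 1 else 0}"])
    fix a assume "a \<in> complex_space n"
    have "a i = frame_map n n (\<lambda>j i. if i = j + 1 then 1 else 0) (\<lambda>j. a (j + 1)) i" for i
    proof (cases "i \<in> {1..n}")
      case True
      have "(\<Sum>j<n. a (j + 1) * (if i = j + 1 then 1 else 0)) = (\<Sum>j<n. if j = i - 1 then a i else 0)"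
        using True by (intro sum.cong) auto
      also have "\<dots> = a i" using True by auto
      finally show ?thesis using True by (simp add: frame_map_def)
    next
      case False
      then show ?thesis using \<open>a \<in> complex_space n\<close>
        by (auto simp: frame_map_def complex_space_def PiE_iff extensional_def)
    qed
    then have "a = frame_map n n (\<lambda>j i. if i = j + 1 then 1 else 0) (\<lambda>j. a (j + 1))" by blast
    then show "\<exists>u\<in>{\<lambda>j i. if i = j + 1 then 1 else 0}. \<exists>x. a = frame_map n n u x" by auto
  qed auto
  moreover have "ereal (real n) \<le> krull_dim (subtopology (zariski_topology n) (complex_space n))"
  proof (rule krull_dim_ge_coordinate_flag[where \<kappa> = Suc and L = "complex_space n"])
    have "complex_space n = zero_locus n {}" by (auto simp: zero_locus_def)
    then show "algebraic_set n (complex_space n)" unfolding algebraic_set_def by blast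
    show "(\<lambda>i. (1 - s) * x i + s * y i) \<in> complex_space n"
      if "x \<in> complex_space n" "y \<in> complex_space n" for x y s
      using that by (auto simp: complex_space_def PiE_iff extensional_def algebra_simps)
    show "\<exists>x\<in>complex_space n. \<forall>i<n. x (Suc i) = 0"
      by (rule bexI[of _ "\<lambda>i\<in>{1..n}. 0"]) (auto simp: complex_space_def)
    show "\<exists>x\<in>complex_space n. x (Suc i) \<noteq> 0 \<and> (\<forall>j. i < j \<and> j < n \<longrightarrow> x (Suc j) = 0)" if "i < n" for i
      using that by (intro bexI[of _ "\<lambda>j\<in>{1..n}. if j = Suc i then 1 else 0"]) (auto simp: complex_space_def)
  qed auto
  ultimately show ?thesis unfolding top by (rule antisym)
qed

section \<open>Continuants at a fixed value of the spectral variable\<close>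

text \<open>
  The reduced continuant with \<open>\<lambda>\<close> absorbed into the potential, as a polynomial in \<open>t\<close> alone.
\<close>

fun continuant :: "(nat \<Rightarrow> complex) \<Rightarrow> (nat \<Rightarrow> complex) \<Rightarrow> nat \<Rightarrow> complex poly" where
  "continuant b c 0 = 1"
| "continuant b c (Suc 0) = [:b 1:]"
| "continuant b c (Suc (Suc k)) =
     [:b (k + 2):] * continuant b c (Suc k) - [:0, c (k + 1):] * continuant b c k"

lemma poly_reduced_continuant:
  "poly (reduced_continuant a c k) [:- \<alpha>:] = continuant (\<lambda>i. a i - \<alpha>) c k"
  by (induction a c k rule: reduced_continuant.induct)
     (simp_all add: pvar_lambda_def pvar_t_def pconst_def smult_diff_left)

lemma has_constant_branch_iff:
  "has_constant_branch (reduced_continuant a c n) \<longleftrightarrow>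
     (\<exists>\<alpha>. continuant (\<lambda>i. a i - \<alpha>) c n = 0)"
proof -
  have "pvar_lambda + pconst \<alpha> dvd P \<longleftrightarrow> poly P [:- \<alpha>:] = 0" for \<alpha> P
    using poly_eq_0_iff_dvd[of P "[:- \<alpha>:]"] by (simp add: pvar_lambda_def pconst_def)
  then show ?thesis by (simp add: has_constant_branch_def poly_reduced_continuant)
qed

lemma continuant_cong:
  assumes "\<And>i. i \<in> {1..k} \<Longrightarrow> b i = b' i" "\<And>i. i \<in> {1..<k} \<Longrightarrow> c i = c' i"
  shows "continuant b c k = continuant b' c' k"
  using assms
proof (induction b c k rule: continuant.induct)
  case (3 b c k)
  have "continuant b c (Suc k) = continuant b' c' (Suc k)" "continuant b c k = continuant b' c' k"
    by (rule 3; use 3 in simp)+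
  then show ?case using 3(3)[of "k + 2"] 3(4)[of "k + 1"] by simp
qed auto

lemma continuant_constant_term: "poly (continuant b c k) 0 = (\<Prod>i=1..k. b i)"
  by (induction b c k rule: continuant.induct)
     (simp_all add: prod.nat_ivl_Suc' mult.commute)

section \<open>Contracting a path at a vanishing entry\<close>

lemma contract_left_end:
  assumes "b 1 = 0"
  shows "continuant b c (k + 2) =
    [:0, - c 1:] * continuant (\<lambda>i. b (i + 2)) (\<lambda>i. c (i + 2)) k"
proof (induction k rule: induct_nat_012)
  case 0
  show ?case using assms by simp
next
  case 1
  show ?case using assms by (simp add: numeral_3_eq_3)
next
  case (ge2 k)
  let ?E = "continuant (\<lambda>i. b (i + 2)) (\<lambda>i. c (i + 2))"
  have "continuant b c (Suc (Suc k) + 2) =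
      [:b (k + 4):] * continuant b c (Suc k + 2) - [:0, c (k + 3):] * continuant b c (k + 2)"
    by (simp add: eval_nat_numeral)
  also have "\<dots> = [:0, - c 1:] * ([:b (k + 4):] * ?E (Suc k) - [:0, c (k + 3):] * ?E k)"
    unfolding ge2 by (simp only: right_diff_distrib mult.left_commute)
  also have "[:b (k + 4):] * ?E (Suc k) - [:0, c (k + 3):] * ?E k = ?E (Suc (Suc k))"
    by (simp add: eval_nat_numeral)
  finally show ?case .
qed

text \<open>
  The path left when \<open>b (l + 1) = 0\<close> and the vertices \<open>l, l + 1, l + 2\<close> merge into the vertex \<open>l\<close>.
  In the expansion of the continuant over matchings of the path, only matchings that contain the
  vertex \<open>l + 1\<close> survive. It is matched to \<open>l\<close> or to \<open>l + 2\<close>, and the other of these two plays the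
  role of the merged vertex: this gives the two summands of the entry \<open>l\<close>. An edge from the merged
  vertex to the left is an edge from \<open>l\<close>, so that \<open>l + 1\<close> is matched to the right; hence the extra
  factor \<open>c (l + 1)\<close> in the coupling \<open>l - 1\<close>, and symmetrically \<open>c l\<close> in the coupling \<open>l\<close>.
\<close>

definition contracted_potential ::
    "nat \<Rightarrow> (nat \<Rightarrow> complex) \<Rightarrow> (nat \<Rightarrow> complex) \<Rightarrow> nat \<Rightarrow> complex" where
  "contracted_potential l b c i =
     (if i < l then b i else if i = l then c l * b (l + 2) + c (l + 1) * b l else b (i + 2))"

definition contracted_couplings :: "nat \<Rightarrow> (nat \<Rightarrow> complex) \<Rightarrow> nat \<Rightarrow> complex" where
  "contracted_couplings l c i =
     (if i + 1 < l then c i else if i + 1 = l then c (l - 1) * c (l + 1)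
      else if i = l then c l * c (l + 2) else c (i + 2))"

text \<open>
  The cases \<open>j = 0\<close> and \<open>j = 1\<close> are computations with the recurrence; beyond the merged vertex both
  sides satisfy the same recurrence.
\<close>

lemma contract_interior:
  assumes "1 \<le> l" "b (l + 1) = 0"
  shows "continuant b c (l + j + 2) =
    [:0, - 1:] * continuant (contracted_potential l b c) (contracted_couplings l c) (l + j)"
proof -
  let ?b = "contracted_potential l b c" and ?c = "contracted_couplings l c"
  let ?D = "continuant b c" and ?E = "continuant ?b ?c"
  obtain p where l: "l = Suc p" using assms(1) by (cases l) auto
  have low: "?E i = ?D i" if "i < l" for i
    by (rule continuant_cong)
       (use that in \<open>auto simp: contracted_potential_def contracted_couplings_def\<close>)
  have D1: "?D (l + 1) = [:0, - c l:] * ?D p"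
    using assms(2) by (simp add: l)
  have D2: "?D (l + 2) = [:0, - 1:] * ?E l"
  proof (cases p)
    case 0
    then show ?thesis using D1 by (simp add: l contracted_potential_def eval_nat_numeral)
  next
    case (Suc q)
    have "?E l = [:?b l:] * ?D p - [:0, ?c p:] * ?D q"
      using low[of p] low[of q] by (simp add: l Suc)
    moreover have "[:?b l:] = [:c l:] * [:b (l + 2):] + [:c (l + 1):] * [:b l:]"
      by (simp add: contracted_potential_def)
    moreover have "[:0, ?c p:] = [:c (l + 1):] * [:0, c p:]"
      by (simp add: contracted_couplings_def l)
    moreover have "[:0, - c l:] = [:0, - 1:] * [:c l:]" "[:0, c (l + 1):] = - [:0, - 1:] * [:c (l + 1):]"
      by simp_all
    moreover have "?D l = [:b l:] * ?D p - [:0, c p:] * ?D q"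
      by (simp add: l Suc)
    moreover have "?D (l + 2) = [:b (l + 2):] * ?D (l + 1) - [:0, c (l + 1):] * ?D l"
      by simp
    ultimately show ?thesis using D1 by algebra
  qed
  have D3: "?D (l + 3) = [:0, - 1:] * ?E (l + 1)"
  proof -
    have "?D (l + 3) = [:b (l + 3):] * ?D (l + 2) - [:0, c (l + 2):] * ?D (l + 1)"
      by (simp add: eval_nat_numeral)
    moreover have "?E (l + 1) = [:b (l + 3):] * ?E l - [:0, ?c l:] * ?D p"
      using low[of p] by (simp add: l contracted_potential_def eval_nat_numeral)
    moreover have "[:0, ?c l:] = [:c l:] * [:0, c (l + 2):]"
      by (simp add: contracted_couplings_def)
    moreover have "[:0, - c l:] = [:0, - 1:] * [:c l:]" by simp
    ultimately show ?thesis using D1 D2 by algebra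
  qed
  show ?thesis
  proof (induction j rule: induct_nat_012)
    case 0
    then show ?case using D2 by simp
  next
    case 1
    then show ?case using D3 by (simp add: eval_nat_numeral)
  next
    case (ge2 j)
    have "?D (l + Suc (Suc j) + 2) =
        [:b (l + j + 4):] * ?D (l + Suc j + 2) - [:0, c (l + j + 3):] * ?D (l + j + 2)"
      by (simp add: eval_nat_numeral)
    moreover have "?E (l + Suc (Suc j)) = [:b (l + j + 4):] * ?E (l + Suc j)
        - [:0, c (l + j + 3):] * ?E (l + j)"
      by (simp add: contracted_potential_def contracted_couplings_def eval_nat_numeral)
    ultimately show ?case using ge2 by algebra
  qed
qed

text \<open>
  The three possible positions of \<open>k\<close> in one form suited to induction: \<open>b\<close> is recovered from the
  shorter potential \<open>b'\<close> by a fixed linear map, whose \<open>i\<close>-th coordinate is a multiple \<open>q i\<close> of a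
  single coordinate \<open>p i\<close>, up to a multiple of a fixed vector \<open>s\<close>. The free scalar \<open>z\<close> is \<open>b 2\<close>,
  \<open>b (n + 1)\<close> or, in the interior, the entry to the left of \<open>k\<close>; the entry to the right of \<open>k\<close> is
  then determined by the merged one because the coupling dividing it is nonzero.
\<close>

lemma vanishing_entry_reduction:
  assumes c: "\<And>i. i \<in> {1..n + 1} \<Longrightarrow> c i \<noteq> 0" and k: "k \<in> {1..n + 2}" and "1 \<le> n"
  shows "\<exists>c' p q s. (\<forall>i\<in>{1..n - 1}. c' i \<noteq> 0) \<and> (\<forall>i\<in>{1..n + 2}. p i \<in> {1..n}) \<and>
    (\<forall>b. b k = 0 \<longrightarrow> continuant b c (n + 2) = 0 \<longrightarrow>
       (\<exists>b' z. continuant b' c' n = 0 \<and> (\<forall>i\<in>{1..n + 2}. b i = q i * b' (p i) + z * s i)))"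
    (is "\<exists>c' p q s. ?P c' p q s")
proof -
  consider "k = 1" | "k = n + 2" | l where "k = l + 1" "1 \<le> l" "l \<le> n"
  proof (cases "k = 1 \<or> k = n + 2")
    case False
    then have "k = (k - 1) + 1" "1 \<le> k - 1" "k - 1 \<le> n" using k by auto
    then show ?thesis by (rule that(3))
  qed (use that(1,2) in blast)
  then show ?thesis
  proof cases
    case 1
    define p where "p i = (if i \<le> 2 then 1 else i - 2)" for i :: nat
    define q where "q i = (if i \<le> 2 then 0 else 1 :: complex)" for i :: nat
    define s where "s i = (if i = 2 then 1 else 0 :: complex)" for i :: nat
    have "?P (\<lambda>i. c (i + 2)) p q s"
    proof (intro conjI allI impI)
      fix b assume "b k = 0" "continuant b c (n + 2) = 0"
      then have "continuant (\<lambda>i. b (i + 2)) (\<lambda>i. c (i + 2)) n = 0"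
        using contract_left_end[of b c n] c[of 1] 1 by simp
      moreover have "\<forall>i\<in>{1..n + 2}. b i = q i * b (p i + 2) + b 2 * s i"
      proof
        fix i assume "i \<in> {1..n + 2}"
        then consider "i = 1" | "i = 2" | "i > 2" by fastforce
        then show "b i = q i * b (p i + 2) + b 2 * s i"
          using \<open>b k = 0\<close> 1 le_add_diff_inverse2[of 2 i]
          by cases (simp_all add: p_def q_def s_def del: add_2_eq_Suc')
      qed
      ultimately show "\<exists>b' z. continuant b' (\<lambda>i. c (i + 2)) n = 0 \<and>
          (\<forall>i\<in>{1..n + 2}. b i = q i * b' (p i) + z * s i)"
        by - (rule exI[of _ "\<lambda>i. b (i + 2)"], rule exI[of _ "b 2"], rule conjI)
    qed (use c \<open>1 \<le> n\<close> in \<open>auto simp: p_def\<close>)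
    then show ?thesis
      by - (rule exI[of _ "\<lambda>i. c (i + 2)"], rule exI[of _ p], rule exI[of _ q], rule exI[of _ s])
  next
    case 2
    define p where "p i = (if i \<le> n then i else 1)" for i :: nat
    define q where "q i = (if i \<le> n then 1 else 0 :: complex)" for i :: nat
    define s where "s i = (if i = n + 1 then 1 else 0 :: complex)" for i :: nat
    have "?P c p q s"
    proof (intro conjI allI impI)
      fix b assume b: "b k = 0" "continuant b c (n + 2) = 0"
      then have "continuant b c n = 0" using c[of "n + 1"] 2 by simp
      moreover have "\<forall>i\<in>{1..n + 2}. b i = q i * b (p i) + b (n + 1) * s i"
      proof
        fix i assume "i \<in> {1..n + 2}"
        then consider "i \<le> n" | "i = n + 1" | "i = n + 2" by fastforce
        then show "b i = q i * b (p i) + b (n + 1) * s i"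
          using b(1) 2 by cases (simp_all add: p_def q_def s_def)
      qed
      ultimately show "\<exists>b' z. continuant b' c n = 0 \<and>
          (\<forall>i\<in>{1..n + 2}. b i = q i * b' (p i) + z * s i)"
        by - (rule exI[of _ b], rule exI[of _ "b (n + 1)"], rule conjI)
    qed (use c \<open>1 \<le> n\<close> in \<open>auto simp: p_def\<close>)
    then show ?thesis
      by - (rule exI[of _ "c"], rule exI[of _ p], rule exI[of _ q], rule exI[of _ s])
  next
    case (3 l)
    define p where "p i = (if i < l then i else if i \<le> l + 2 then l else i - 2)" for i :: nat
    define q where "q i = (if i = l \<or> i = l + 1 then 0 else if i = l + 2 then 1 / c l else 1)" for i :: nat
    define s where "s i = (if i = l then 1 else if i = l + 2 then - c (l + 1) / c l else 0)" for i :: nat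
    have nz: "c l \<noteq> 0" using c 3 by auto
    have "?P (contracted_couplings l c) p q s"
    proof (intro conjI allI impI)
      fix b assume b: "b k = 0" "continuant b c (n + 2) = 0"
      let ?b' = "contracted_potential l b c"
      have "continuant ?b' (contracted_couplings l c) n = 0"
        using contract_interior[of l b c "n - l"] b 3 by simp
      moreover have "\<forall>i\<in>{1..n + 2}. b i = q i * ?b' (p i) + b l * s i"
      proof
        fix i
        consider "i < l" | "i = l" | "i = l + 1" | "i = l + 2" | "i > l + 2" by linarith
        then show "b i = q i * ?b' (p i) + b l * s i"
        proof cases
          case 4
          then show ?thesis using nz
            by (simp add: p_def q_def s_def contracted_potential_def field_simps)
        next
          case 5
          then have "i - 2 > l" "Suc (Suc (i - 2)) = i" by auto
          then show ?thesis using 5 by (simp add: p_def q_def s_def contracted_potential_def)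
        qed (use b 3 in \<open>auto simp: p_def q_def s_def contracted_potential_def\<close>)
      qed
      ultimately show "\<exists>b' z. continuant b' (contracted_couplings l c) n = 0 \<and>
          (\<forall>i\<in>{1..n + 2}. b i = q i * b' (p i) + z * s i)"
        by - (rule exI[of _ ?b'], rule exI[of _ "b l"], rule conjI)
    qed (use c 3 in \<open>auto simp: p_def contracted_couplings_def\<close>)
    then show ?thesis
      by - (rule exI[of _ "contracted_couplings l c"], rule exI[of _ p], rule exI[of _ q], rule exI[of _ s])
  qed
qed

text \<open>
  The constant term makes one of the finitely many entries vanish. For each choice \<open>k\<close> of that entry
  the frames of the contracted path are pulled back by \<open>(p, q)\<close> and extended by the vector \<open>s\<close>.
\<close>

lemma vanishing_continuant_covered_by_frames:
  assumes "\<And>i. i \<in> {1..2 * m} \<Longrightarrow> c i \<noteq> 0"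
  shows "\<exists>U :: (nat \<Rightarrow> nat \<Rightarrow> complex) set. finite U \<and>
    (\<forall>b. continuant b c (2 * m + 1) = 0 \<longrightarrow>
       (\<exists>u\<in>U. \<exists>x. \<forall>i\<in>{1..2 * m + 1}. b i = (\<Sum>j<m. x j * u j i)))"
  using assms
proof (induction m arbitrary: c)
  case 0
  show ?case by (intro exI[of _ "{\<lambda>_ _. 0}"]) auto
next
  case (Suc m)
  let ?n = "2 * m + 1"
  define covered where "covered U b \<longleftrightarrow>
      (\<exists>u\<in>U. \<exists>x. \<forall>i\<in>{1..?n + 2}. b i = (\<Sum>j<Suc m. x j * u j i))"
    for U :: "(nat \<Rightarrow> nat \<Rightarrow> complex) set" and b
  have "\<exists>U. finite U \<and> (\<forall>b. b k = 0 \<longrightarrow> continuant b c (?n + 2) = 0 \<longrightarrow> covered U b)"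
    if k: "k \<in> {1..?n + 2}" for k
  proof -
    have "\<exists>c' p q s. (\<forall>i\<in>{1..?n - 1}. c' i \<noteq> 0) \<and> (\<forall>i\<in>{1..?n + 2}. p i \<in> {1..?n}) \<and>
        (\<forall>b. b k = 0 \<longrightarrow> continuant b c (?n + 2) = 0 \<longrightarrow>
          (\<exists>b' z. continuant b' c' ?n = 0 \<and> (\<forall>i\<in>{1..?n + 2}. b i = q i * b' (p i) + z * s i)))"
      by (rule vanishing_entry_reduction) (use Suc.prems k in auto)
    then obtain c' p q s where c': "\<forall>i\<in>{1..?n - 1}. c' i \<noteq> 0"
      and p: "\<forall>i\<in>{1..?n + 2}. p i \<in> {1..?n}"
      and red: "\<forall>b. b k = 0 \<longrightarrow> continuant b c (?n + 2) = 0 \<longrightarrow>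
        (\<exists>b' z. continuant b' c' ?n = 0 \<and> (\<forall>i\<in>{1..?n + 2}. b i = q i * b' (p i) + z * s i))"
      by (elim exE conjE) (rule that)
    obtain U :: "(nat \<Rightarrow> nat \<Rightarrow> complex) set" where U: "finite U" "\<And>b. continuant b c' ?n = 0 \<Longrightarrow>
       (\<exists>u\<in>U. \<exists>x. \<forall>i\<in>{1..?n}. b i = (\<Sum>j<m. x j * u j i))"
      using Suc.IH[of c'] c' by auto
    define ext where "ext u j i = (if j < m then q i * u j (p i) else s i)"
      for u :: "nat \<Rightarrow> nat \<Rightarrow> complex" and j i
    have "covered (ext ` U) b"
      if b: "b k = 0" "continuant b c (?n + 2) = 0" for b
    proof -
      obtain b' z where b': "continuant b' c' ?n = 0" "\<forall>i\<in>{1..?n + 2}. b i = q i * b' (p i) + z * s i"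
        using red b by blast
      obtain u x where u: "u \<in> U" "\<forall>i\<in>{1..?n}. b' i = (\<Sum>j<m. x j * u j i)"
        using U(2)[OF b'(1)] by blast
      have "b i = (\<Sum>j<Suc m. (x(m := z)) j * ext u j i)" if i: "i \<in> {1..?n + 2}" for i
      proof -
        have "b i = q i * (\<Sum>j<m. x j * u j (p i)) + z * s i"
          using b'(2) i p u(2) by metis
        then show ?thesis by (simp add: ext_def sum_distrib_left mult.left_commute)
      qed
      then have "\<forall>i\<in>{1..?n + 2}. b i = (\<Sum>j<Suc m. (x(m := z)) j * ext u j i)" by blast
      then show ?thesis
        unfolding covered_def by - (rule bexI[of _ "ext u"], rule exI[of _ "x(m := z)"], use u(1) in auto)
    qed
    then show ?thesis using U(1) by (intro exI[of _ "ext ` U"]) simp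
  qed
  then have "\<forall>k\<in>{1..?n + 2}. \<exists>U. finite U \<and>
      (\<forall>b. b k = 0 \<longrightarrow> continuant b c (?n + 2) = 0 \<longrightarrow> covered U b)" by blast
  from bchoice[OF this] obtain U where U: "\<And>k. k \<in> {1..?n + 2} \<Longrightarrow> finite (U k)"
    "\<And>k b. k \<in> {1..?n + 2} \<Longrightarrow> b k = 0 \<Longrightarrow> continuant b c (?n + 2) = 0 \<Longrightarrow> covered (U k) b"
    by blast
  have "covered (\<Union>k\<in>{1..?n + 2}. U k) b" if "continuant b c (?n + 2) = 0" for b
  proof -
    have "(\<Prod>i=1..?n + 2. b i) = 0"
      using continuant_constant_term[of b c "?n + 2"] that by (simp del: continuant.simps)
    then obtain k where k: "k \<in> {1..?n + 2}" "b k = 0"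
      by (metis prod_zero_iff finite_atLeastAtMost)
    then have "covered (U k) b" using U(2) that by blast
    then show ?thesis using k(1) unfolding covered_def by blast
  qed
  then have "\<forall>b. continuant b c (?n + 2) = 0 \<longrightarrow> covered (\<Union>k\<in>{1..?n + 2}. U k) b" by blast
  moreover have "finite (\<Union>k\<in>{1..?n + 2}. U k)" using U(1) by blast
  moreover have "2 * Suc m + 1 = ?n + 2" by simp
  ultimately show ?case
    unfolding covered_def by - (rule exI[of _ "\<Union>k\<in>{1..?n + 2}. U k"], simp only: simp_thms)
qed

text \<open>
  The zero propagates along the odd indices: at such an index the entry kills the first term of the
  recurrence, and the second is a multiple of the previous odd continuant.
\<close>

lemma odd_continuant_vanishes:
  assumes "\<And>j. j \<le> m \<Longrightarrow> b (2 * j + 1) = 0"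
  shows "continuant b c (2 * m + 1) = 0"
  using assms
proof (induction m)
  case (Suc m)
  have "continuant b c (2 * m + 1) = 0" using Suc by simp
  moreover have "b (2 * Suc m + 1) = 0" by (rule Suc.prems) simp
  ultimately show ?case by simp
qed simp

section \<open>The codimension of the potentials with a constant branch\<close>

theorem theorem4p7:
  fixes m n :: nat and c :: "nat \<Rightarrow> complex"
  assumes "n = 2 * m + 1"
    and "c \<in> complex_space (n - 1)"
    and "\<And>i. i \<in> {1..n - 1} \<Longrightarrow> c i \<noteq> 0"
  shows "codim_in (zariski_topology n)
           {a \<in> complex_space n. has_constant_branch (reduced_continuant a c n)} = ereal (real m)"
proof -
  define S where "S = {a \<in> complex_space n. has_constant_branch (reduced_continuant a c n)}"
  have S_iff: "a \<in> S \<longleftrightarrow> a \<in> complex_space n \<and> (\<exists>\<alpha>. continuant (\<lambda>i. a i - \<alpha>) c n = 0)" for a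
    by (simp add: S_def has_constant_branch_iff)
  have S: "S \<subseteq> complex_space n" by (auto simp: S_def)
  have "krull_dim (subtopology (zariski_topology n) S) \<le> ereal (real (Suc m))"
  proof -
    obtain U :: "(nat \<Rightarrow> nat \<Rightarrow> complex) set" where U: "finite U"
      "\<And>b. continuant b c n = 0 \<Longrightarrow> \<exists>u\<in>U. \<exists>x. \<forall>i\<in>{1..n}. b i = (\<Sum>j<m. x j * u j i)"
      using vanishing_continuant_covered_by_frames[of m c] assms(1,3) by auto
    \<comment> \<open>The extra vector \<open>(1, \<dots>, 1)\<close> accounts for the shift by \<open>\<alpha>\<close>.\<close>
    define adjoin where "adjoin u = (\<lambda>j i. if j < m then u j i else 1)"
      for u :: "nat \<Rightarrow> nat \<Rightarrow> complex"
    show ?thesis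
    proof (rule krull_dim_le_frame_size[OF S, where U = "adjoin ` U"])
      fix a assume "a \<in> S"
      then obtain \<alpha> where a: "a \<in> complex_space n" "continuant (\<lambda>i. a i - \<alpha>) c n = 0"
        using S_iff by blast
      obtain u x where u: "u \<in> U" "\<forall>i\<in>{1..n}. a i - \<alpha> = (\<Sum>j<m. x j * u j i)"
        using U(2)[OF a(2)] by blast
      have "a i = frame_map n (Suc m) (adjoin u) (x(m := \<alpha>)) i" for i
      proof (cases "i \<in> {1..n}")
        case True
        then have "a i = (\<Sum>j<m. x j * u j i) + \<alpha>"
          using u(2) by (metis diff_add_cancel)
        then show ?thesis using True by (simp add: frame_map_def adjoin_def)
      next
        case False
        then show ?thesis using a(1)
          by (auto simp: frame_map_def complex_space_def PiE_iff extensional_def)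
      qed
      then show "\<exists>v\<in>adjoin ` U. \<exists>x. a = frame_map n (Suc m) v x"
        using u(1) by blast
    qed (use U(1) in simp)
  qed
  moreover have "ereal (real (Suc m)) \<le> krull_dim (subtopology (zariski_topology n) S)"
  proof -
    \<comment> \<open>All odd entries agree. The coordinates \<open>1, 2, 4, \<dots>, 2 * m\<close> are free on this subspace.\<close>
    define L where "L = {a \<in> complex_space n. \<forall>j\<le>m. a (2 * j + 1) = a 1}"
    define \<kappa> where "\<kappa> i = (if i = 0 then 1 else 2 * i)" for i :: nat
    show ?thesis
    proof (rule krull_dim_ge_coordinate_flag[where L = L and \<kappa> = \<kappa>])
      show "L \<subseteq> S"
      proof
        fix a assume a: "a \<in> L"
        then have "continuant (\<lambda>i. a i - a 1) c n = 0"
          unfolding assms(1) by (intro odd_continuant_vanishes) (simp add: L_def)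
        then show "a \<in> S" using a by (auto simp: S_iff L_def)
      qed
      let ?F = "(\<lambda>j a. a (2 * j + 1) + (- 1) * a 1) ` {..m}"
      have "(\<lambda>a. a (2 * j + 1) + (- 1) * a 1) \<in> polynomial_maps n" if "j \<le> m" for j
        using that assms(1)
        by (intro polynomial_maps.add polynomial_maps.mult polynomial_maps.const
            polynomial_maps.coord) auto
      then have "?F \<subseteq> polynomial_maps n" by blast
      moreover have "L = zero_locus n ?F" by (auto simp: L_def zero_locus_def)
      ultimately show "algebraic_set n L" unfolding algebraic_set_def by blast
      show "(\<lambda>i. (1 - s) * x i + s * y i) \<in> L" if "x \<in> L" "y \<in> L" for x y s
        using that by (auto simp: L_def complex_space_def PiE_iff extensional_def algebra_simps)
      show "\<kappa> i \<in> {1..n}" if "i < Suc m" for i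
        using that assms(1) by (auto simp: \<kappa>_def)
      show "\<exists>x\<in>L. \<forall>i<Suc m. x (\<kappa> i) = 0"
        using assms(1)
        by (intro bexI[of _ "\<lambda>i\<in>{1..n}. 0"]) (auto simp: L_def \<kappa>_def complex_space_def)
      show "\<exists>x\<in>L. x (\<kappa> i) \<noteq> 0 \<and> (\<forall>j. i < j \<and> j < Suc m \<longrightarrow> x (\<kappa> j) = 0)" if i: "i < Suc m" for i
      proof (cases "i = 0")
        case True
        then show ?thesis using assms(1)
          by (intro bexI[of _ "\<lambda>k\<in>{1..n}. if odd k then 1 else 0"])
             (auto simp: L_def \<kappa>_def complex_space_def)
      next
        case False
        have "2 * j + 1 \<noteq> 2 * i" for j by presburger
        then show ?thesis using assms(1) False i
          by (intro bexI[of _ "\<lambda>k\<in>{1..n}. if k = 2 * i then 1 else 0"])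
             (auto simp: L_def \<kappa>_def complex_space_def)
      qed
    qed (rule S)
  qed
  ultimately have "krull_dim (subtopology (zariski_topology n) S) = ereal (real (Suc m))"
    by (rule antisym)
  then show ?thesis
    unfolding codim_in_def S_def[symmetric] krull_dim_complex_space by (simp add: assms(1))
qed

end
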